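(* Let $X=H(\mathbb{C})$ be the Fréchet space of entire functions. Let $(\Omega,\mathcal{F},\mu,\tau)$ be an ergodic measure-preserving dynamical system and let $(A_1,A_2)$ be a partition of $\Omega$ into two measurable subsets with $\min\{\mu(A_1),\mu(A_2)\}>0$. Let $T(\omega)=B_w$ if $\omega\in A_1$ and $T(\omega)=B_v$ if $\omega\in A_2$, where $$w_l=l\quad\text{and}\quad v_l=1/l\qquad\text{for every } l\ge1,$$ and let $T_n(\omega)=T(\tau^{n-1}\omega)\cdots T(\tau\omega)T(\omega)$ for $n\ge1$. (1) If $\mu(A_1)>\mu(A_2)$, then $(T_n(\omega))_{n\ge1}$ is mixing for almost every $\omega\in\Omega$. (2) If $\mu(A_1)<\mu(A_2)$, then for almost every $\omega\in\Omega$ the sequence $(T_n(\omega))_{n\ge1}$ is not universal. Moreover, in the case where $\Omega=\mathbb{T}=\mathbb{R}/\mathbb{Z}$ (identified with $[0,1)$) with normalized Lebesgue measure, $\tau$ is the doubling map $\tau x=2x$, $A_1=[0,1/2)$ and $A_2=[1/2,1)$, for almost every $\omega\in\Omega$ the sequence $(T_n(\omega))_{n\ge1}$ is not universal.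
   Context: $H(\mathbb{C})$ carries the topology of uniform convergence on compact sets; an entire function $\sum_{n\ge0}a_nz^n$ is identified with the sequence $(a_n)_{n\ge0}$, so that $e_n$ is the monomial $z\mapsto z^n$. The weighted shift $B_w$ with nonzero weights $w=(w_n)_{n\ge1}$ is the operator with $B_we_0=0$, $B_we_n=w_ne_{n-1}$ for $n\ge1$; it is continuous on $H(\mathbb{C})$ if and only if $\sup_n|w_n|^{1/n}<\infty$. A measure-preserving dynamical system is a probability space with a measurable map $\tau$ preserving $\mu$; ergodic means that $\tau^{-1}(A)=A$ implies $\mu(A)\in\{0,1\}$. A sequence $(S_n)_{n\ge1}$ of continuous maps on a metric space $X$ is universal if there is $x\in X$ such that $\{S_nx:n\ge1\}$ is dense in $X$; it is mixing if for all nonempty open $U,V\subset X$ there is $N\ge1$ such that $S_n(U)\cap V\neq\emptyset$ for every $n\ge N$. *)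

theory Defs
  imports "HOL-Probability.Probability" "HOL-Complex_Analysis.Complex_Analysis"
begin

definition entire_functions :: "(complex \<Rightarrow> complex) set" where
  "entire_functions = {f. f holomorphic_on UNIV}"

text \<open>The space of entire functions, with the topology of uniform convergence on compact sets.\<close>

definition entire_topology :: "(complex \<Rightarrow> complex) topology" where
  "entire_topology = topology (\<lambda>U. U \<subseteq> entire_functions \<and>
     (\<forall>f\<in>U. \<exists>K \<epsilon>. compact K \<and> \<epsilon> > 0 \<and>
        {g \<in> entire_functions. \<forall>z\<in>K. dist (g z) (f z) < \<epsilon>} \<subseteq> U))"

lemma openin_entire_topology:
  "openin entire_topology U \<longleftrightarrow> U \<subseteq> entire_functions \<and>
     (\<forall>f\<in>U. \<exists>K \<epsilon>. compact K \<and> \<epsilon> > 0 \<and>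
        {g \<in> entire_functions. \<forall>z\<in>K. dist (g z) (f z) < \<epsilon>} \<subseteq> U)"
proof -
  define nhd where "nhd f U \<longleftrightarrow> (\<exists>K \<epsilon>. compact K \<and> \<epsilon> > 0 \<and>
     {g \<in> entire_functions. \<forall>z\<in>K. dist (g z) (f z) < \<epsilon>} \<subseteq> U)" for f U
  let ?P = "\<lambda>U. U \<subseteq> entire_functions \<and> (\<forall>f\<in>U. nhd f U)"
  have mono: "nhd f V" if "nhd f U" "U \<subseteq> V" for f U V
    using that unfolding nhd_def by (meson subset_trans)
  have int: "nhd f (S \<inter> T)" if S: "nhd f S" and T: "nhd f T" for f S T
  proof -
    obtain K d where K: "compact K" "d > 0"
      "{g \<in> entire_functions. \<forall>z\<in>K. dist (g z) (f z) < d} \<subseteq> S"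
      using S unfolding nhd_def by (elim exE conjE)
    obtain L e where L: "compact L" "e > 0"
      "{g \<in> entire_functions. \<forall>z\<in>L. dist (g z) (f z) < e} \<subseteq> T"
      using T unfolding nhd_def by (elim exE conjE)
    have "{g \<in> entire_functions. \<forall>z\<in>K \<union> L. dist (g z) (f z) < min d e} \<subseteq> S \<inter> T"
    proof
      fix g assume g: "g \<in> {g \<in> entire_functions. \<forall>z\<in>K \<union> L. dist (g z) (f z) < min d e}"
      have "g \<in> S" using g by (intro subsetD[OF K(3)]) simp
      moreover have "g \<in> T" using g by (intro subsetD[OF L(3)]) simp
      ultimately show "g \<in> S \<inter> T" ..
    qed
    moreover have "compact (K \<union> L)" "min d e > 0"
      using K(1,2) L(1,2) by auto
    ultimately show ?thesis
      unfolding nhd_def by (intro exI conjI)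
  qed
  have "istopology ?P"
    unfolding istopology_def
  proof (intro conjI allI impI)
    fix S T assume "?P S" "?P T"
    then show "S \<inter> T \<subseteq> entire_functions" "\<forall>f\<in>S \<inter> T. nhd f (S \<inter> T)"
      using int by auto
  next
    fix \<K> assume K: "\<forall>S\<in>\<K>. ?P S"
    then show "\<Union>\<K> \<subseteq> entire_functions" by (simp add: Sup_le_iff)
    show "\<forall>f\<in>\<Union>\<K>. nhd f (\<Union>\<K>)"
      using K mono[OF _ Union_upper] by (metis UnionE)
  qed
  then show ?thesis
    unfolding entire_topology_def nhd_def by (simp only: topology_inverse')
qed

lemma topspace_entire_topology [simp]: "topspace entire_topology = entire_functions"
proof
  show "topspace entire_topology \<subseteq> entire_functions"
    using openin_entire_topology openin_topspace by blast
  have "openin entire_topology entire_functions"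
    unfolding openin_entire_topology
    by (auto intro!: exI[of _ "{}"] exI[of _ "1::real"])
  then show "entire_functions \<subseteq> topspace entire_topology"
    by (rule openin_subset)
qed

definition taylor_coeff :: "(complex \<Rightarrow> complex) \<Rightarrow> nat \<Rightarrow> complex" where
  "taylor_coeff f n = (deriv ^^ n) f 0 / fact n"

text \<open>
  On coefficient sequences the weighted shift is \<open>(a\<^sub>n)\<^sub>n \<mapsto> (w\<^bsub>n+1\<^esub> a\<^bsub>n+1\<^esub>)\<^sub>n\<close>.
  The series converges everywhere for every entire \<open>f\<close> when \<open>sup\<^sub>n |w\<^sub>n|\<^bsup>1/n\<^esup> < \<infinity>\<close>;
  the value \<open>w 0\<close> is not used.
\<close>

definition weighted_shift :: "(nat \<Rightarrow> complex) \<Rightarrow> (complex \<Rightarrow> complex) \<Rightarrow> complex \<Rightarrow> complex" where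
  "weighted_shift w f = (\<lambda>z. \<Sum>n. w (Suc n) * taylor_coeff f (Suc n) * z ^ n)"

lemma taylor_coeff_monomial: "taylor_coeff (\<lambda>z. z ^ k) n = (if n = k then 1 else 0)"
proof -
  have "(\<lambda>z::complex. z ^ k) has_fps_expansion (fps_X ^ k)"
    by (intro fps_expansion_intros)
  then have "fps_expansion (\<lambda>z::complex. z ^ k) 0 = fps_X ^ k"
    by (rule fps_expansion_eqI)
  then have "fps_nth (fps_expansion (\<lambda>z::complex. z ^ k) 0) n = fps_nth (fps_X ^ k) n"
    by simp
  then show ?thesis
    by (simp add: fps_expansion_def taylor_coeff_def fps_X_power_iff)
qed

lemma weighted_shift_monomial_0: "weighted_shift w (\<lambda>z. z ^ 0) = (\<lambda>z. 0)"
  unfolding weighted_shift_def taylor_coeff_monomial by simp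

lemma weighted_shift_monomial_Suc:
  "weighted_shift w (\<lambda>z. z ^ Suc n) = (\<lambda>z. w (Suc n) * z ^ n)"
proof
  fix z
  have "(\<lambda>m. w (Suc m) * taylor_coeff (\<lambda>z. z ^ Suc n) (Suc m) * z ^ m) sums
      (\<Sum>m\<in>{n}. w (Suc m) * taylor_coeff (\<lambda>z. z ^ Suc n) (Suc m) * z ^ m)"
    by (rule sums_finite) (auto simp: taylor_coeff_monomial simp del: power_Suc)
  then show "weighted_shift w (\<lambda>z. z ^ Suc n) z = w (Suc n) * z ^ n"
    by (simp add: weighted_shift_def taylor_coeff_monomial sums_iff del: power_Suc)
qed

definition universal_sequence :: "'a topology \<Rightarrow> (nat \<Rightarrow> 'a \<Rightarrow> 'a) \<Rightarrow> bool" where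
  "universal_sequence X S \<longleftrightarrow>
     (\<exists>x\<in>topspace X. X closure_of {S n x |n. n \<ge> 1} = topspace X)"

definition mixing_sequence :: "'a topology \<Rightarrow> (nat \<Rightarrow> 'a \<Rightarrow> 'a) \<Rightarrow> bool" where
  "mixing_sequence X S \<longleftrightarrow>
     (\<forall>U V. openin X U \<and> U \<noteq> {} \<and> openin X V \<and> V \<noteq> {} \<longrightarrow>
        (\<exists>N\<ge>1. \<forall>n\<ge>N. S n ` U \<inter> V \<noteq> {}))"

definition measure_preserving_system :: "'a measure \<Rightarrow> ('a \<Rightarrow> 'a) \<Rightarrow> bool" where
  "measure_preserving_system M \<tau> \<longleftrightarrow>
     prob_space M \<and> \<tau> \<in> measurable M M \<and> distr M M \<tau> = M"

definition ergodic_system :: "'a measure \<Rightarrow> ('a \<Rightarrow> 'a) \<Rightarrow> bool" where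
  "ergodic_system M \<tau> \<longleftrightarrow> measure_preserving_system M \<tau> \<and>
     (\<forall>A\<in>sets M. \<tau> -` A \<inter> space M = A \<longrightarrow> measure M A \<in> {0, 1})"

text \<open>\<open>op_product \<tau> T n \<omega> = T (\<tau>\<^bsup>n-1\<^esup> \<omega>) \<circ> \<dots> \<circ> T (\<tau> \<omega>) \<circ> T \<omega>\<close>\<close>

primrec op_product :: "('w \<Rightarrow> 'w) \<Rightarrow> ('w \<Rightarrow> 'a \<Rightarrow> 'a) \<Rightarrow> nat \<Rightarrow> 'w \<Rightarrow> 'a \<Rightarrow> 'a" where
  "op_product \<tau> T 0 \<omega> = id"
| "op_product \<tau> T (Suc n) \<omega> = T ((\<tau> ^^ n) \<omega>) \<circ> op_product \<tau> T n \<omega>"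

text \<open>The circle is identified with \<open>[0,1)\<close>.\<close>

definition doubling_map :: "real \<Rightarrow> real" where
  "doubling_map x = frac (2 * x)"

end

theory Submission
  imports Defs "HOL-Real_Asymp.Real_Asymp"
begin

text \<open>
  Let \<open>\<sigma> j\<close> be \<open>1\<close> or \<open>-1\<close> according to whether the orbit visits \<open>A1\<close> or \<open>A2\<close> at time \<open>j\<close>.
  Both operators move a Taylor coefficient one place to the left, from index \<open>l\<close> to \<open>l - 1\<close>,
  and multiply it by \<open>l\<close> or by \<open>1/l\<close>. The coefficient of \<open>z\<^sup>k\<close> in \<open>T\<^sub>n f\<close> is
  therefore \<open>exp (L n k)\<close> times the coefficient of \<open>z\<^bsup>n+k\<^esup>\<close> in \<open>f\<close>, where
  \<open>L n k = (\<Sum>j<n. \<sigma> j * ln (n + k - j))\<close>: the factor applied at time \<open>j\<close> is the one of index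
  \<open>n + k - j\<close>. So everything is decided by the growth of \<open>L n k\<close> in \<open>n\<close>, measured against the
  coefficients of an entire function, which decay faster than every geometric sequence.

  \<^item> If \<open>L n 0 \<le> C * n\<close> eventually, then \<open>T\<^sub>n f 0\<close> is a bounded sequence for every entire \<open>f\<close>, and no
    orbit can be dense (\<open>not_universal_if_linear_log_weights\<close>).
  \<^item> If \<open>L n k\<close> grows faster than linearly, then a polynomial \<open>g\<close> has preimages under \<open>T\<^sub>n\<close>, obtained
    by shifting its coefficients \<open>n\<close> places to the right and dividing by the weights, that tend to
    \<open>0\<close>. Adding the first \<open>n\<close> Taylor terms of \<open>f\<close>, which \<open>T\<^sub>n\<close> kills, gives points near \<open>f\<close> that
    \<open>T\<^sub>n\<close> sends to \<open>g\<close>: the sequence is mixing (\<open>mixing_if_linear_growth\<close>).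

  Since \<open>ln (n + k - j)\<close> decreases in \<open>j\<close>, summation by parts turns upper bounds on the partial sums
  of signs into upper bounds on sums weighted by logarithms. For an ergodic system such bounds come
  from a one-sided form of Birkhoff's theorem (\<open>birkhoff_sums_bounded_above\<close>): an integrable
  function of negative mean has Birkhoff sums that are almost surely bounded above. If \<open>A1\<close> is the
  smaller set, this applies to the sign itself and gives \<open>L n 0 \<le> C * ln n\<close>. If \<open>A1\<close> is the larger
  set, it applies to \<open>\<delta>\<close> minus the sign for some \<open>\<delta> > 0\<close> and gives
  \<open>L n k \<ge> \<delta> * ln (fact n) - C * ln (n + k)\<close>.

  For the doubling map the mean is \<open>0\<close>, but the signs are independent and symmetric under Lebesgue
  measure, so \<open>L n 0\<close> is typically of order \<open>sqrt n * ln n\<close>. An exponential moment estimate shows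
  that almost surely \<open>L n 0 \<le> n\<close> for all large \<open>n\<close> (\<open>doubling_log_weights_le\<close>), which is enough for
  the first criterion.
\<close>

section \<open>Entire functions and their Taylor coefficients\<close>

lemma entire_sums_taylor:
  assumes "f \<in> entire_functions"
  shows "(\<lambda>n. taylor_coeff f n * z ^ n) sums f z"
proof -
  have "f holomorphic_on ball 0 (norm z + 1)"
    using assms holomorphic_on_subset unfolding entire_functions_def by blast
  from holomorphic_power_series[OF this, of z] show ?thesis
    by (simp add: taylor_coeff_def)
qed

lemma entire_eqI:
  assumes "f \<in> entire_functions" "g \<in> entire_functions"
    and "\<And>n. taylor_coeff f n = taylor_coeff g n"
  shows "f = g"
  using entire_sums_taylor[OF assms(1)] entire_sums_taylor[OF assms(2)]
  by (auto simp: assms(3) intro: sums_unique2)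

lemma taylor_coeff_0: "taylor_coeff f 0 = f 0"
  by (simp add: taylor_coeff_def)

lemma
  assumes "\<And>z. (\<lambda>n. c n * z ^ n) sums f z"
  shows entire_powser: "f \<in> entire_functions"
    and taylor_coeff_powser: "taylor_coeff f n = c n"
proof -
  have "conv_radius c = \<infinity>"
    using assms by (intro conv_radius_inftyI'') (auto simp: sums_iff)
  then have R: "fps_conv_radius (Abs_fps c) = \<infinity>"
    by (simp add: fps_conv_radius_def)
  have eq: "f = eval_fps (Abs_fps c)"
    using assms by (auto simp: eval_fps_def sums_iff)
  show "f \<in> entire_functions"
    unfolding eq entire_functions_def by (auto intro!: holomorphic_intros simp: R)
  have "f has_fps_expansion Abs_fps c"
    unfolding has_fps_expansion_def eq by (simp add: R)
  from fps_nth_fps_expansion[OF this, of n] show "taylor_coeff f n = c n"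
    by (simp add: taylor_coeff_def)
qed

lemma
  fixes c :: "nat \<Rightarrow> complex"
  shows entire_polynomial: "(\<lambda>z. \<Sum>i<N. c i * z ^ i) \<in> entire_functions"
    and taylor_coeff_polynomial:
      "taylor_coeff (\<lambda>z. \<Sum>i<N. c i * z ^ i) k = (if k < N then c k else 0)"
proof -
  have "(\<lambda>n. (if n < N then c n else 0) * z ^ n) sums (\<Sum>i<N. c i * z ^ i)" for z
    using sums_finite[of "{..<N}" "\<lambda>n. (if n < N then c n else 0) * z ^ n"] by simp
  note * = this
  show "(\<lambda>z. \<Sum>i<N. c i * z ^ i) \<in> entire_functions"
    using * by (rule entire_powser)
  show "taylor_coeff (\<lambda>z. \<Sum>i<N. c i * z ^ i) k = (if k < N then c k else 0)"
    using * by (rule taylor_coeff_powser)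
qed

text \<open>The terms of the Taylor series at the point \<open>exp C\<close> are bounded because the series converges there.\<close>
lemma entire_taylor_geometric_bound:
  assumes "f \<in> entire_functions"
  obtains B where "\<And>n. norm (taylor_coeff f n) * exp (C * real n) \<le> B"
proof -
  have "summable (\<lambda>n. taylor_coeff f n * of_real (exp C) ^ n)"
    using entire_sums_taylor[OF assms] by (rule sums_summable)
  then have "Bseq (\<lambda>n. taylor_coeff f n * of_real (exp C) ^ n)"
    by (intro convergent_imp_Bseq convergentI) (rule summable_LIMSEQ_zero)
  then obtain B where B: "\<And>n. norm (taylor_coeff f n * of_real (exp C) ^ n) \<le> B"
    unfolding Bseq_def by blast
  have "norm (taylor_coeff f n) * exp (C * real n) \<le> B" for n
    using B[of n] unfolding exp_of_nat2_mult norm_mult norm_power norm_of_real by simp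
  then show thesis by (rule that)
qed

lemma eventually_taylor_polynomial_close:
  assumes "f \<in> entire_functions" "compact K" "e > 0"
  shows "\<forall>\<^sub>F n in sequentially. \<forall>z\<in>K. dist (\<Sum>i<n. taylor_coeff f i * z ^ i) (f z) < e"
proof -
  obtain r where r: "K \<subseteq> cball 0 r"
    using compact_imp_bounded[OF assms(2)] bounded_iff[of K] by (auto simp: subset_eq)
  have sums: "(\<lambda>n. taylor_coeff f n * z ^ n) sums f z" for z
    using assms(1) by (rule entire_sums_taylor)
  have "conv_radius (taylor_coeff f) = \<infinity>"
    using sums by (intro conv_radius_inftyI'') (auto simp: sums_iff)
  then have "uniform_limit (cball 0 r) (\<lambda>n z. \<Sum>i<n. taylor_coeff f i * (z - 0) ^ i)
      (\<lambda>z. \<Sum>i. taylor_coeff f i * (z - 0) ^ i) sequentially"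
    by (intro powser_uniform_limit) simp
  also have "(\<lambda>z. \<Sum>i. taylor_coeff f i * (z - 0) ^ i) = f"
    using sums by (auto simp: sums_iff)
  finally have "uniform_limit (cball 0 r) (\<lambda>n z. \<Sum>i<n. taylor_coeff f i * z ^ i) f sequentially"
    by (simp only: diff_zero)
  from uniform_limitD[OF this assms(3)] show ?thesis
    by (rule eventually_mono) (use r in blast)
qed

lemma entire_nhd:
  assumes "openin entire_topology U" "f \<in> U"
  obtains K e where "compact K" "e > 0"
    "\<And>g. g \<in> entire_functions \<Longrightarrow> (\<And>z. z \<in> K \<Longrightarrow> dist (g z) (f z) < e) \<Longrightarrow> g \<in> U"
proof -
  from assms obtain K e where K: "compact K" "e > 0"
    and sub: "{g \<in> entire_functions. \<forall>z\<in>K. dist (g z) (f z) < e} \<subseteq> U"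
    unfolding openin_entire_topology by (elim conjE ballE[of _ _ f] exE) simp_all
  show thesis
  proof (rule that[OF K])
    fix g assume "g \<in> entire_functions" "\<And>z. z \<in> K \<Longrightarrow> dist (g z) (f z) < e"
    then show "g \<in> U" by (intro subsetD[OF sub]) simp
  qed
qed

section \<open>Coefficients of products of the two shifts\<close>

text \<open>
  Weights bounded by those of differentiation cannot destroy convergence: the shifted series is
  dominated termwise by the series of the derivative. Both \<open>l\<close> and \<open>1/l\<close> are covered.
\<close>
lemma
  assumes f: "f \<in> entire_functions" and u: "\<And>n. norm (u (Suc n)) \<le> real (Suc n)"
  shows weighted_shift_entire: "weighted_shift u f \<in> entire_functions"
    and taylor_coeff_weighted_shift:
      "taylor_coeff (weighted_shift u f) k = u (Suc k) * taylor_coeff f (Suc k)"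
proof -
  let ?a = "taylor_coeff f"
  have sums: "(\<lambda>n. u (Suc n) * ?a (Suc n) * z ^ n) sums weighted_shift u f z" for z
  proof -
    define r where "r = norm z + 1"
    have "summable (\<lambda>n. norm (diffs ?a n * z ^ n))"
    proof (rule powser_insidea[where x = "of_real r"])
      show "summable (\<lambda>n. diffs ?a n * of_real r ^ n)"
        using sums_summable[OF entire_sums_taylor[OF f]] by (rule termdiff_converges_all)
    qed (simp add: r_def)
    moreover have "norm (u (Suc n) * ?a (Suc n) * z ^ n) \<le> norm (diffs ?a n * z ^ n)" for n
      using u[of n] unfolding diffs_def norm_mult norm_of_nat
      by (intro mult_right_mono) auto
    ultimately have "summable (\<lambda>n. u (Suc n) * ?a (Suc n) * z ^ n)"
      by (rule summable_comparison_test'[where N = 0])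
    then show ?thesis
      unfolding weighted_shift_def by (rule summable_sums)
  qed
  show "weighted_shift u f \<in> entire_functions"
    using sums by (rule entire_powser)
  show "taylor_coeff (weighted_shift u f) k = u (Suc k) * ?a (Suc k)"
    using sums by (rule taylor_coeff_powser)
qed

text \<open>
  All that the dynamics needs to know about the operators \<open>T\<^sub>n\<close> for one fixed \<open>\<omega>\<close>. The products of weights are
  written as exponentials because they are then controlled by sums of the signs \<open>\<sigma>\<close>.
\<close>
definition log_weighted_shifts ::
  "(nat \<Rightarrow> real) \<Rightarrow> (nat \<Rightarrow> (complex \<Rightarrow> complex) \<Rightarrow> complex \<Rightarrow> complex) \<Rightarrow> bool" where
  "log_weighted_shifts \<sigma> S \<longleftrightarrow> (\<forall>n. \<forall>f\<in>entire_functions. S n f \<in> entire_functions \<and>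
     (\<forall>k. taylor_coeff (S n f) k =
        of_real (exp (\<Sum>j<n. \<sigma> j * ln (real (n + k - j)))) * taylor_coeff f (n + k)))"

lemma op_product_log_weighted_shifts:
  assumes w: "\<And>l. l \<ge> 1 \<Longrightarrow> w l = of_nat l"
    and v: "\<And>l. l \<ge> 1 \<Longrightarrow> v l = 1 / of_nat l"
    and T: "\<And>j. (\<sigma> j = 1 \<and> T ((\<tau> ^^ j) \<omega>) = weighted_shift w) \<or>
                 (\<sigma> j = -1 \<and> T ((\<tau> ^^ j) \<omega>) = weighted_shift v)"
  shows "log_weighted_shifts \<sigma> (\<lambda>n. op_product \<tau> T n \<omega>)"
proof -
  have step: "T ((\<tau> ^^ j) \<omega>) f \<in> entire_functions \<and>
      taylor_coeff (T ((\<tau> ^^ j) \<omega>) f) k =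
        of_real (exp (\<sigma> j * ln (real (Suc k)))) * taylor_coeff f (Suc k)"
    if f: "f \<in> entire_functions" for f j k
  proof -
    have "norm (w (Suc n)) \<le> real (Suc n)" for n
      using w[of "Suc n"] by (simp del: of_nat_Suc)
    note W = weighted_shift_entire[OF f this] taylor_coeff_weighted_shift[OF f this]
    have "norm (v (Suc n)) \<le> real (Suc n)" for n
    proof -
      have "norm (v (Suc n)) = 1 / real (Suc n)"
        using v[of "Suc n"] by (simp add: norm_divide del: of_nat_Suc)
      also have "\<dots> \<le> real (Suc n)"
        by (simp add: field_simps)
      finally show ?thesis .
    qed
    note V = weighted_shift_entire[OF f this] taylor_coeff_weighted_shift[OF f this]
    from T[of j] show ?thesis
    proof (elim disjE conjE)
      assume "\<sigma> j = 1" "T ((\<tau> ^^ j) \<omega>) = weighted_shift w"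
      then show ?thesis
        using W w[of "Suc k"] by (simp add: exp_ln del: of_nat_Suc)
    next
      assume "\<sigma> j = -1" "T ((\<tau> ^^ j) \<omega>) = weighted_shift v"
      then show ?thesis
        using V v[of "Suc k"] by (simp add: exp_minus divide_inverse del: of_nat_Suc)
    qed
  qed
  have "op_product \<tau> T n \<omega> f \<in> entire_functions \<and>
      (\<forall>k. taylor_coeff (op_product \<tau> T n \<omega> f) k =
        of_real (exp (\<Sum>j<n. \<sigma> j * ln (real (n + k - j)))) * taylor_coeff f (n + k))"
    if f: "f \<in> entire_functions" for f n
  proof (induction n)
    case 0
    show ?case using f by simp
  next
    case (Suc n)
    then have "op_product \<tau> T n \<omega> f \<in> entire_functions" by blast
    note step = step[OF this, of n]
    have "taylor_coeff (op_product \<tau> T (Suc n) \<omega> f) k =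
        of_real (exp (\<Sum>j<Suc n. \<sigma> j * ln (real (Suc n + k - j)))) * taylor_coeff f (Suc n + k)" for k
    proof -
      have "taylor_coeff (op_product \<tau> T n \<omega> f) (Suc k) =
          of_real (exp (\<Sum>j<n. \<sigma> j * ln (real (Suc n + k - j)))) * taylor_coeff f (Suc n + k)"
        using spec[OF conjunct2[OF Suc.IH], of "Suc k"] by (simp only: add_Suc add_Suc_right)
      with step[of k] show ?thesis
        by (simp add: exp_add mult.assoc mult.left_commute del: of_nat_Suc)
    qed
    with step show ?case by simp
  qed
  then show ?thesis
    unfolding log_weighted_shifts_def by blast
qed

section \<open>Growth of the logarithmic weights\<close>

text \<open>
  Summation by parts: with \<open>X n\<close> the partial sums of \<open>x\<close>, the weighted sum is a combination of the
  \<open>X n\<close> with the nonnegative coefficients \<open>c m - c (m + 1)\<close> and a last one \<open>c m\<close>, which add up to \<open>c 0\<close>.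
\<close>
lemma sum_mult_decreasing_le:
  fixes c x :: "nat \<Rightarrow> real"
  assumes "antimono c" "\<And>i. c i \<ge> 0" "\<And>n. (\<Sum>i<n. x i) \<le> C" "C \<ge> 0"
  shows "(\<Sum>i<n. x i * c i) \<le> C * c 0"
proof (cases n)
  case 0
  then show ?thesis using assms(2,4) by simp
next
  case (Suc m)
  have "(\<Sum>i<Suc m. x i * c i) - (\<Sum>i<Suc m. x i) * c m \<le> C * (c 0 - c m)"
  proof (induction m)
    case 0
    then show ?case by simp
  next
    case (Suc m)
    have "(\<Sum>i<Suc m. x i) * (c m - c (Suc m)) \<le> C * (c m - c (Suc m))"
      using antimonoD[OF assms(1), of m "Suc m"] by (intro mult_right_mono assms(3)) simp
    with Suc show ?case by (simp add: algebra_simps)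
  qed
  moreover have "(\<Sum>i<Suc m. x i) * c m \<le> C * c m"
    by (intro mult_right_mono assms(2,3))
  ultimately show ?thesis
    unfolding \<open>n = Suc m\<close> by (simp add: algebra_simps)
qed

lemma sum_mult_ln_le:
  fixes x :: "nat \<Rightarrow> real"
  assumes "\<And>n. (\<Sum>i<n. x i) \<le> C" "C \<ge> 0"
  shows "(\<Sum>i<n. x i * ln (real (N - i))) \<le> C * ln (real N)"
proof -
  have "ln (real (N - j)) \<le> ln (real (N - i))" if "i \<le> j" for i j
    using that by (cases "N \<le> i"; cases "N \<le> j") (auto intro: ln_ge_zero)
  then have "antimono (\<lambda>i. ln (real (N - i)))"
    by (intro antimonoI)
  moreover have "ln (real (N - i)) \<ge> 0" for i
    by (cases "N - i") auto
  ultimately show ?thesis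
    using sum_mult_decreasing_le[of "\<lambda>i. ln (real (N - i))" x C n] assms by simp
qed

text \<open>
  The right-hand side is at least \<open>ln (fact n)\<close>, and \<open>n\<^sup>n / fact n\<close> is a single term of the series of
  \<open>exp n\<close>.
\<close>
lemma sum_ln_ge: "real n * ln (real n) - real n \<le> (\<Sum>j<n. ln (real (n + k - j)))"
proof (cases "n = 0")
  case False
  have "real n ^ n / fact n \<le> exp (real n)"
  proof -
    have "(\<Sum>i\<in>{n}. real n ^ i / fact i) \<le> (\<Sum>i. real n ^ i / fact i)"
      using summable_exp_generic[of "real n"]
      by (intro sum_le_suminf) (auto simp: divide_inverse mult.commute)
    then show ?thesis
      by (simp add: exp_def divide_inverse mult.commute)
  qed
  then have "ln (real n ^ n / fact n) \<le> real n"
    using False by (metis divide_pos_pos fact_gt_zero ln_exp ln_mono of_nat_0_less_iff gr0I zero_less_power)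
  then have "real n * ln (real n) - real n \<le> ln (fact n)"
    using False by (simp add: ln_div ln_realpow)
  also have "fact n = (\<Prod>j<n. real (n - j))"
  proof -
    have "(fact n :: real) = real (\<Prod>{1..n})" by (simp add: fact_prod)
    also have "\<Prod>{1..n} = (\<Prod>j<n. n - j)"
      by (rule prod.reindex_bij_witness[of _ "\<lambda>j. n - j" "\<lambda>j. n - j"]) auto
    finally show ?thesis by simp
  qed
  also have "ln (\<Prod>j<n. real (n - j)) = (\<Sum>j<n. ln (real (n - j)))"
    by (rule ln_prod) auto
  also have "\<dots> \<le> (\<Sum>j<n. ln (real (n + k - j)))"
    by (intro sum_mono) auto
  finally show ?thesis .
qed simp

text \<open>
  Summation by parts applied to \<open>\<delta> - \<sigma>\<close> compares the weights with those of the constant sequence \<open>\<delta>\<close>,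
  whose product is at least \<open>fact n\<close> to the power \<open>\<delta>\<close>; the constant \<open>C\<close> costs only a polynomial factor.
\<close>
lemma log_weights_lower_bound:
  fixes \<sigma> :: "nat \<Rightarrow> real"
  assumes "\<delta> > 0" "C \<ge> 0" "\<And>n. (\<Sum>i<n. \<delta> - \<sigma> i) \<le> C"
  shows "\<delta> * (real n * ln (real n) - real n) - C * ln (real (n + k))
           \<le> (\<Sum>j<n. \<sigma> j * ln (real (n + k - j)))"
proof -
  have "(\<Sum>j<n. (\<delta> - \<sigma> j) * ln (real (n + k - j))) \<le> C * ln (real (n + k))"
    using assms(3,2) by (rule sum_mult_ln_le)
  moreover have "(\<Sum>j<n. (\<delta> - \<sigma> j) * ln (real (n + k - j))) =
      \<delta> * (\<Sum>j<n. ln (real (n + k - j))) - (\<Sum>j<n. \<sigma> j * ln (real (n + k - j)))"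
    by (simp only: left_diff_distrib sum_subtractf sum_distrib_left)
  moreover have "\<delta> * (real n * ln (real n) - real n) \<le> \<delta> * (\<Sum>j<n. ln (real (n + k - j)))"
    using assms(1) by (intro mult_left_mono sum_ln_ge) auto
  ultimately show ?thesis by linarith
qed

lemma inverse_weights_tendsto_0:
  fixes \<sigma> :: "nat \<Rightarrow> real"
  assumes "\<delta> > 0" "C \<ge> 0" "\<And>n. (\<Sum>i<n. \<delta> - \<sigma> i) \<le> C" and r: "r > 0"
  shows "(\<lambda>n. exp (- (\<Sum>j<n. \<sigma> j * ln (real (n + k - j)))) * r ^ (n + k)) \<longlonglongrightarrow> 0"
proof (rule tendsto_sandwich[OF _ _ tendsto_const])
  let ?b = "\<lambda>n. exp (C * ln (real n + real k) - \<delta> * (real n * ln (real n) - real n)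
                     + (real n + real k) * ln r)"
  show "?b \<longlonglongrightarrow> 0"
    using assms(1) by real_asymp
  show "\<forall>\<^sub>F n in sequentially.
      exp (- (\<Sum>j<n. \<sigma> j * ln (real (n + k - j)))) * r ^ (n + k) \<le> ?b n"
  proof (rule always_eventually, rule allI)
    fix n
    have "r ^ (n + k) = exp ((real n + real k) * ln r)"
      using r by (simp only: of_nat_add[symmetric] exp_of_nat_mult exp_ln)
    then show "exp (- (\<Sum>j<n. \<sigma> j * ln (real (n + k - j)))) * r ^ (n + k) \<le> ?b n"
      using log_weights_lower_bound[OF assms(1-3), of n k]
      by (simp only: exp_add[symmetric] exp_le_cancel_iff of_nat_add)
  qed
qed (use r in auto)

section \<open>Criteria for universality and mixing\<close>

text \<open>
  Evaluation at \<open>0\<close> is continuous and onto \<open>\<complex>\<close>, so a dense orbit would have dense, in particular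
  unbounded, values at \<open>0\<close>; but \<open>exp (C * n)\<close> times the \<open>n\<close>-th Taylor coefficient is bounded.
\<close>
lemma not_universal_if_linear_log_weights:
  assumes S: "log_weighted_shifts \<sigma> S"
    and bound: "\<forall>\<^sub>F n in sequentially. (\<Sum>j<n. \<sigma> j * ln (real (n - j))) \<le> C * real n"
  shows "\<not> universal_sequence entire_topology S"
proof
  assume "universal_sequence entire_topology S"
  then obtain f where f: "f \<in> entire_functions"
    and dense: "entire_topology closure_of {S n f |n. n \<ge> 1} = entire_functions"
    unfolding universal_sequence_def topspace_entire_topology by blast
  obtain B where B: "\<And>n. norm (taylor_coeff f n) * exp (C * real n) \<le> B"
    using entire_taylor_geometric_bound[OF f] by blast
  have "\<forall>\<^sub>F n in sequentially. norm (S n f 0) \<le> B"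
    using bound
  proof eventually_elim
    case (elim n)
    have "S n f 0 = taylor_coeff (S n f) 0" by (rule taylor_coeff_0[symmetric])
    also have "\<dots> = of_real (exp (\<Sum>j<n. \<sigma> j * ln (real (n - j)))) * taylor_coeff f n"
      using S f unfolding log_weighted_shifts_def by simp
    finally have "norm (S n f 0) = norm (taylor_coeff f n) * exp (\<Sum>j<n. \<sigma> j * ln (real (n - j)))"
      by (simp only: norm_mult norm_of_real abs_exp_cancel mult.commute)
    also have "\<dots> \<le> norm (taylor_coeff f n) * exp (C * real n)"
      using elim by (intro mult_left_mono) auto
    finally show ?case using B[of n] by linarith
  qed
  then have "Bseq (\<lambda>n. S n f 0)" by (rule BfunI)
  then obtain K where K: "K > 0" "\<And>n. norm (S n f 0) \<le> K"
    unfolding Bseq_def by blast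
  let ?U = "{g \<in> entire_functions. K < norm (g 0)}"
  have "openin entire_topology ?U"
    unfolding openin_entire_topology
  proof (intro conjI ballI)
    fix g assume "g \<in> ?U"
    moreover have "K < norm (h 0)" if "dist (h 0) (g 0) < norm (g 0) - K" for h :: "complex \<Rightarrow> complex"
      using that norm_triangle_ineq2[of "g 0" "h 0"] by (simp add: dist_norm norm_minus_commute)
    ultimately show "\<exists>L e. compact L \<and> e > 0 \<and>
        {h \<in> entire_functions. \<forall>z\<in>L. dist (h z) (g z) < e} \<subseteq> ?U"
      by (intro exI[of _ "{0}"] exI[of _ "norm (g 0) - K"]) auto
  qed auto
  moreover have "(\<lambda>z. of_real (K + 1)) \<in> ?U"
    using K(1) by (auto simp: entire_functions_def simp del: of_real_add)
  moreover from this have "(\<lambda>z. of_real (K + 1)) \<in> entire_topology closure_of {S n f |n. n \<ge> 1}"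
    unfolding dense by blast
  ultimately have "\<exists>h\<in>{S n f |n. n \<ge> 1}. h \<in> ?U"
    unfolding in_closure_of by (elim conjE allE[of _ ?U]) simp
  then obtain n where "S n f \<in> ?U" by blast
  then show False using K(2)[of n] by simp
qed

text \<open>
  The point of \<open>U\<close> that lands in \<open>V\<close> is a polynomial: the Taylor polynomial of degree below \<open>n\<close> of some
  \<open>f\<close> in \<open>U\<close>, followed by the preimage under \<open>T\<^sub>n\<close> of a fixed Taylor polynomial of some \<open>g\<close> in \<open>V\<close>.
\<close>
lemma mixing_if_linear_growth:
  assumes S: "log_weighted_shifts \<sigma> S"
    and \<sigma>: "\<delta> > 0" "C \<ge> 0" "\<And>n. (\<Sum>i<n. \<delta> - \<sigma> i) \<le> C"
  shows "mixing_sequence entire_topology S"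
  unfolding mixing_sequence_def
proof (intro allI impI, elim conjE)
  fix U V assume UV: "openin entire_topology U" "U \<noteq> {}" "openin entire_topology V" "V \<noteq> {}"
  then obtain f g where fU: "f \<in> U" and gV: "g \<in> V" by blast
  have f: "f \<in> entire_functions" and g: "g \<in> entire_functions"
    using UV fU gV by (auto simp: openin_entire_topology)
  obtain K e where K: "compact K" "e > 0"
    "\<And>h. h \<in> entire_functions \<Longrightarrow> (\<And>z. z \<in> K \<Longrightarrow> dist (h z) (f z) < e) \<Longrightarrow> h \<in> U"
    using entire_nhd[OF UV(1) fU] by blast
  obtain K' e' where K': "compact K'" "e' > 0"
    "\<And>h. h \<in> entire_functions \<Longrightarrow> (\<And>z. z \<in> K' \<Longrightarrow> dist (h z) (g z) < e') \<Longrightarrow> h \<in> V"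
    using entire_nhd[OF UV(3) gV] by blast
  obtain r where r: "r > 0" "\<And>z. z \<in> K \<Longrightarrow> norm z \<le> r"
    using compact_imp_bounded[OF K(1)] unfolding bounded_pos by blast
  define a b where "a = taylor_coeff f" and "b = taylor_coeff g"
  obtain m where m: "\<And>z. z \<in> K' \<Longrightarrow> dist (\<Sum>i<m. b i * z ^ i) (g z) < e'"
    using eventually_taylor_polynomial_close[OF g K'(1,2)]
    unfolding b_def by (auto simp: eventually_sequentially)
  define L where "L n k = (\<Sum>j<n. \<sigma> j * ln (real (n + k - j)))" for n k
  \<comment> \<open>The coefficients below \<open>n\<close> are shifted out by \<open>S n\<close>; those from \<open>n\<close> on are undone by its weights.\<close>
  define c where "c n i = (if i < n then a i else b (i - n) * of_real (exp (- L n (i - n))))" for n i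
  define h where "h n z = (\<Sum>i<n + m. c n i * z ^ i)" for n z
  have h_split: "h n z = (\<Sum>i<n. a i * z ^ i) + (\<Sum>k<m. b k * of_real (exp (- L n k)) * z ^ (n + k))"
    for n z
  proof -
    have "(\<Sum>i<n + l. c n i * z ^ i) =
        (\<Sum>i<n. a i * z ^ i) + (\<Sum>k<l. b k * of_real (exp (- L n k)) * z ^ (n + k))" for l
      by (induction l) (simp_all add: c_def)
    then show ?thesis unfolding h_def by blast
  qed
  have h: "h n \<in> entire_functions" "taylor_coeff (h n) i = (if i < n + m then c n i else 0)" for n i
    unfolding h_def by (rule entire_polynomial, rule taylor_coeff_polynomial)
  have image: "S n (h n) \<in> V" for n
  proof -
    have Sh: "S n (h n) \<in> entire_functions"
      "\<And>k. taylor_coeff (S n (h n)) k = of_real (exp (L n k)) * taylor_coeff (h n) (n + k)"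
      using S h(1) unfolding log_weighted_shifts_def L_def by blast+
    have "S n (h n) = (\<lambda>z. \<Sum>i<m. b i * z ^ i)"
    proof (rule entire_eqI[OF Sh(1) entire_polynomial])
      fix k
      show "taylor_coeff (S n (h n)) k = taylor_coeff (\<lambda>z. \<Sum>i<m. b i * z ^ i) k"
        unfolding Sh(2) h(2) taylor_coeff_polynomial
        by (simp add: c_def exp_minus)
    qed
    then show ?thesis using K'(3) entire_polynomial m by simp
  qed
  have "(\<lambda>n. \<Sum>k<m. norm (b k) * (exp (- L n k) * r ^ (n + k))) \<longlonglongrightarrow> (\<Sum>k<m. norm (b k) * 0)"
    unfolding L_def using \<sigma> r(1) by (intro tendsto_sum tendsto_mult_left inverse_weights_tendsto_0)
  then have "\<forall>\<^sub>F n in sequentially. (\<Sum>k<m. norm (b k) * (exp (- L n k) * r ^ (n + k))) < e / 2"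
    using K(2) by (intro order_tendstoD(2)) auto
  moreover have "\<forall>\<^sub>F n in sequentially. \<forall>z\<in>K. dist (\<Sum>i<n. a i * z ^ i) (f z) < e / 2"
    unfolding a_def using K(2) by (intro eventually_taylor_polynomial_close f K(1)) simp
  ultimately have "\<forall>\<^sub>F n in sequentially. h n \<in> U"
  proof eventually_elim
    case (elim n)
    show ?case
    proof (rule K(3)[OF h(1)])
      fix z assume z: "z \<in> K"
      have "norm (\<Sum>k<m. b k * of_real (exp (- L n k)) * z ^ (n + k))
          \<le> (\<Sum>k<m. norm (b k) * (exp (- L n k) * r ^ (n + k)))"
      proof (rule sum_norm_le)
        fix k
        have "norm z ^ (n + k) \<le> r ^ (n + k)"
          using r(2)[OF z] by (intro power_mono) auto
        then show "norm (b k * of_real (exp (- L n k)) * z ^ (n + k))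
            \<le> norm (b k) * (exp (- L n k) * r ^ (n + k))"
          unfolding norm_mult norm_power norm_of_real abs_exp_cancel mult.assoc
          by (intro mult_left_mono) auto
      qed
      moreover have "dist (h n z) (f z) \<le> dist (\<Sum>i<n. a i * z ^ i) (f z)
          + norm (\<Sum>k<m. b k * of_real (exp (- L n k)) * z ^ (n + k))"
        unfolding h_split dist_norm
        by (rule order.trans[OF eq_refl norm_triangle_ineq]) (simp add: algebra_simps)
      ultimately show "dist (h n z) (f z) < e"
        using elim z by fastforce
    qed
  qed
  then obtain N where "\<And>n. n \<ge> N \<Longrightarrow> h n \<in> U"
    unfolding eventually_sequentially by blast
  then show "\<exists>N\<ge>1. \<forall>n\<ge>N. S n ` U \<inter> V \<noteq> {}"
    using image by (intro exI[of _ "max 1 N"]) (auto simp: disjoint_iff)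
qed

section \<open>A one-sided ergodic theorem\<close>

text \<open>
  The maximum of the Birkhoff sums over at most \<open>n\<close> terms, the empty sum included. The recursion
  through \<open>\<tau> x\<close> makes its transformation under the dynamics the definition.
\<close>
primrec birkhoff_max :: "('a \<Rightarrow> 'a) \<Rightarrow> ('a \<Rightarrow> real) \<Rightarrow> nat \<Rightarrow> 'a \<Rightarrow> real" where
  "birkhoff_max \<tau> \<psi> 0 x = 0"
| "birkhoff_max \<tau> \<psi> (Suc n) x = max 0 (\<psi> x + birkhoff_max \<tau> \<psi> n (\<tau> x))"

lemma birkhoff_max_nonneg: "birkhoff_max \<tau> \<psi> n x \<ge> 0"
  by (cases n) auto

lemma birkhoff_max_Suc: "birkhoff_max \<tau> \<psi> n x \<le> birkhoff_max \<tau> \<psi> (Suc n) x"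
proof (induction n arbitrary: x)
  case (Suc n)
  show ?case
    unfolding birkhoff_max.simps(2)[of \<tau> \<psi> n x] birkhoff_max.simps(2)[of \<tau> \<psi> "Suc n" x]
    by (intro max.mono add_left_mono Suc.IH order_refl)
qed simp

lemma birkhoff_sum_le_max: "(\<Sum>i<n. \<psi> ((\<tau> ^^ i) x)) \<le> birkhoff_max \<tau> \<psi> n x"
proof (induction n arbitrary: x)
  case (Suc n)
  have "(\<Sum>i<Suc n. \<psi> ((\<tau> ^^ i) x)) = \<psi> x + (\<Sum>i<n. \<psi> ((\<tau> ^^ i) (\<tau> x)))"
    by (simp only: sum.lessThan_Suc_shift funpow_Suc_right o_apply funpow_0)
  also have "\<dots> \<le> birkhoff_max \<tau> \<psi> (Suc n) x"
    using Suc[of "\<tau> x"] by simp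
  finally show ?case .
qed simp

text \<open>
  Boundedness is a property of orbits, which makes the set of points with unbounded sums
  invariant. Natural numbers as bounds keep that set a countable combination of measurable sets.
\<close>
lemma birkhoff_max_bounded_iff:
  "(\<exists>C. \<forall>n. birkhoff_max \<tau> \<psi> n (\<tau> x) \<le> real C) \<longleftrightarrow> (\<exists>C. \<forall>n. birkhoff_max \<tau> \<psi> n x \<le> real C)"
proof safe
  fix C assume C: "\<forall>n. birkhoff_max \<tau> \<psi> n (\<tau> x) \<le> real C"
  define D where "D = nat \<lceil>\<bar>\<psi> x\<bar> + real C\<rceil>"
  have D: "\<bar>\<psi> x\<bar> + real C \<le> real D" unfolding D_def by linarith
  have "birkhoff_max \<tau> \<psi> n x \<le> real D" for n
  proof (cases n)
    case (Suc m)
    then show ?thesis using C[rule_format, of m] D abs_ge_self[of "\<psi> x"] by simp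
  qed simp
  then show "\<exists>C. \<forall>n. birkhoff_max \<tau> \<psi> n x \<le> real C" by blast
next
  fix C assume C: "\<forall>n. birkhoff_max \<tau> \<psi> n x \<le> real C"
  define D where "D = nat \<lceil>\<bar>\<psi> x\<bar> + real C\<rceil>"
  have D: "\<bar>\<psi> x\<bar> + real C \<le> real D" unfolding D_def by linarith
  have "birkhoff_max \<tau> \<psi> n (\<tau> x) \<le> real D" for n
    using C[rule_format, of "Suc n"] D by simp
  then show "\<exists>C. \<forall>n. birkhoff_max \<tau> \<psi> n (\<tau> x) \<le> real C" by blast
qed

text \<open>
  Write \<open>m\<^sub>n\<close> for the maximal sums. By ergodicity the set where they are unbounded has measure \<open>0\<close>
  or \<open>1\<close>. The difference \<open>m\<^sub>n\<^sub>+\<^sub>1 - m\<^sub>n \<circ> \<tau>\<close> equals \<open>max (- m\<^sub>n \<circ> \<tau>) \<psi>\<close>, and by invariance of the measure its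
  integral is that of \<open>m\<^sub>n\<^sub>+\<^sub>1 - m\<^sub>n\<close>, hence nonnegative. Were the maximal sums unbounded
  almost everywhere, the difference would converge to \<open>\<psi>\<close>, dominated by \<open>\<bar>\<psi>\<bar>\<close>, and \<open>\<psi>\<close> would have
  a nonnegative integral.
\<close>
lemma birkhoff_sums_bounded_above:
  fixes \<psi> :: "'a \<Rightarrow> real"
  assumes erg: "ergodic_system M \<tau>" and \<psi>: "integrable M \<psi>" and neg: "(\<integral>x. \<psi> x \<partial>M) < 0"
  shows "AE x in M. \<exists>C\<ge>0. \<forall>n. (\<Sum>i<n. \<psi> ((\<tau> ^^ i) x)) \<le> C"
proof -
  let ?m = "birkhoff_max \<tau> \<psi>"
  interpret prob_space M
    using erg unfolding ergodic_system_def measure_preserving_system_def by simp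
  have \<tau>[measurable]: "\<tau> \<in> measurable M M" and pres: "distr M M \<tau> = M"
    using erg unfolding ergodic_system_def measure_preserving_system_def by auto
  have [measurable]: "\<psi> \<in> borel_measurable M" using \<psi> by simp
  have meas[measurable]: "?m n \<in> borel_measurable M" for n
  proof (induction n)
    case (Suc n)
    note [measurable] = Suc
    show ?case unfolding birkhoff_max.simps by measurable
  qed simp
  have int_\<tau>: "integrable M (\<lambda>x. f (\<tau> x))" "(\<integral>x. f (\<tau> x) \<partial>M) = (\<integral>x. f x \<partial>M)"
    if f: "integrable M f" for f :: "'a \<Rightarrow> real"
    using integrable_distr[OF \<tau>, of f] integral_distr[OF \<tau>, of f] f
    by (simp_all add: pres)
  have int: "integrable M (?m n)" for n
  proof (induction n)
    case (Suc n)
    show ?case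
      unfolding birkhoff_max.simps using int_\<tau>(1)[OF Suc] \<psi> by (intro integrable_max) auto
  qed simp
  define A where "A = {x \<in> space M. \<not> (\<exists>C. \<forall>n. ?m n x \<le> real C)}"
  have "A \<in> sets M" unfolding A_def by measurable
  moreover have "\<tau> -` A \<inter> space M = A"
  proof (rule set_eqI)
    fix x
    show "x \<in> \<tau> -` A \<inter> space M \<longleftrightarrow> x \<in> A"
      using measurable_space[OF \<tau>, of x] birkhoff_max_bounded_iff[of \<tau> \<psi> x]
      unfolding A_def by blast
  qed
  ultimately have "prob A \<in> {0, 1}"
    using erg unfolding ergodic_system_def by blast
  moreover have "prob A \<noteq> 1"
  proof
    assume "prob A = 1"
    then have AE_A: "AE x in M. x \<in> A" by (rule AE_prob_1)
    let ?d = "\<lambda>n x. max (- ?m n (\<tau> x)) (\<psi> x)"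
    have d_eq: "?d n x = ?m (Suc n) x - ?m n (\<tau> x)" for n x by simp
    have "(\<integral>x. ?d n x \<partial>M) \<ge> 0" for n
    proof -
      have "(\<integral>x. ?d n x \<partial>M) = (\<integral>x. ?m (Suc n) x \<partial>M) - (\<integral>x. ?m n x \<partial>M)"
        unfolding d_eq using int[of "Suc n"] int_\<tau>[OF int[of n]] by (simp del: birkhoff_max.simps)
      also have "\<dots> \<ge> 0"
        using integral_mono[OF int int birkhoff_max_Suc, of n] by (simp only: diff_ge_0_iff_ge)
      finally show ?thesis .
    qed
    moreover have "(\<lambda>n. \<integral>x. ?d n x \<partial>M) \<longlonglongrightarrow> (\<integral>x. \<psi> x \<partial>M)"
    proof (rule integral_dominated_convergence[where w = "\<lambda>x. \<bar>\<psi> x\<bar>"])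
      show "AE x in M. (\<lambda>n. ?d n x) \<longlonglongrightarrow> \<psi> x"
        using AE_A
      proof eventually_elim
        case (elim x)
        then have "\<not> (\<exists>C. \<forall>n. ?m n (\<tau> x) \<le> real C)"
          unfolding A_def birkhoff_max_bounded_iff by simp
        then obtain N where N: "?m N (\<tau> x) > real (nat \<lceil>- \<psi> x\<rceil>)"
          by (meson not_le)
        have "?d n x = \<psi> x" if "n \<ge> N" for n
        proof -
          have "?m N (\<tau> x) \<le> ?m n (\<tau> x)"
            using lift_Suc_mono_le[where f = "\<lambda>n. ?m n (\<tau> x)", OF birkhoff_max_Suc that] .
          with N show ?thesis by linarith
        qed
        then show ?case
          by (intro tendsto_eventually) (auto simp: eventually_sequentially)
      qed
      show "AE x in M. norm (?d n x) \<le> \<bar>\<psi> x\<bar>" for n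
      proof (rule AE_I2)
        fix x
        have "?m n (\<tau> x) \<ge> 0" by (rule birkhoff_max_nonneg)
        then show "norm (?d n x) \<le> \<bar>\<psi> x\<bar>" unfolding real_norm_def by linarith
      qed
    qed (use \<psi> in auto)
    ultimately have "(\<integral>x. \<psi> x \<partial>M) \<ge> 0"
      by (intro LIMSEQ_le_const) auto
    with neg show False by simp
  qed
  ultimately have "prob A = 0" by simp
  then have "AE x in M. x \<notin> A"
    using \<open>A \<in> sets M\<close> by (simp add: prob_eq_0)
  then show ?thesis
  proof (rule AE_mp, intro AE_I2 impI)
    fix x assume "x \<in> space M" "x \<notin> A"
    then obtain C where "\<And>n. ?m n x \<le> real C" unfolding A_def by blast
    then show "\<exists>C\<ge>0. \<forall>n. (\<Sum>i<n. \<psi> ((\<tau> ^^ i) x)) \<le> C"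
      using birkhoff_sum_le_max[of \<psi> \<tau> x] order_trans by (intro exI[of _ "real C"]) fastforce
  qed
qed

section \<open>Sums of signs along the doubling map\<close>

text \<open>Compare the two power series termwise, using \<open>2 ^ n * fact n \<le> fact (2 * n)\<close>.\<close>
lemma cosh_le_exp_half_square: "cosh x \<le> exp (x\<^sup>2 / 2)" for x :: real
proof -
  have exp: "(\<lambda>n. (x\<^sup>2 / 2) ^ n /\<^sub>R fact n) sums exp (x\<^sup>2 / 2)"
    by (rule exp_converges)
  have "(\<lambda>n. if even n then x ^ n /\<^sub>R fact n else 0) sums cosh x"
    by (rule cosh_converges)
  then have cosh: "(\<lambda>n. x ^ (2 * n) /\<^sub>R fact (2 * n)) sums cosh x"
    by (subst (asm) sums_mono_reindex[of "\<lambda>n. 2 * n", symmetric])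
       (auto simp: strict_mono_def elim: oddE evenE)
  have "x ^ (2 * n) /\<^sub>R fact (2 * n) \<le> (x\<^sup>2 / 2) ^ n /\<^sub>R fact n" for n
  proof -
    have "2 ^ n * fact n \<le> (fact (2 * n) :: real)"
    proof (induction n)
      case (Suc n)
      have "2 ^ Suc n * fact (Suc n) = (2 * (real n + 1)) * (2 ^ n * fact n)"
        by (simp add: algebra_simps)
      also have "\<dots> \<le> (2 * (real n + 1) * (2 * real n + 1)) * fact (2 * n)"
        by (intro mult_mono Suc.IH) (auto simp: algebra_simps)
      also have "\<dots> = fact (2 * Suc n)"
        by (simp add: algebra_simps)
      finally show ?case .
    qed simp
    then have "x ^ (2 * n) / fact (2 * n) \<le> x ^ (2 * n) / (2 ^ n * fact n)"
      by (intro divide_left_mono) auto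
    also have "\<dots> = (x\<^sup>2 / 2) ^ n / fact n"
      by (simp only: power_mult power_divide divide_divide_eq_left)
    finally show ?thesis
      by (simp only: real_scaleR_def divide_inverse_commute)
  qed
  from this cosh exp show ?thesis
    by (rule sums_le)
qed

definition doubling_sign :: "real \<Rightarrow> real" where
  "doubling_sign x = (if x < 1/2 then 1 else -1)"

lemma doubling_map_measurable [measurable]: "doubling_map \<in> borel_measurable borel"
  unfolding doubling_map_def frac_def by measurable

lemma doubling_map_funpow_measurable [measurable]: "(doubling_map ^^ n) \<in> borel_measurable borel"
  by (induction n) (auto simp: measurable_comp)

lemma doubling_sign_measurable [measurable]: "doubling_sign \<in> borel_measurable borel"
  unfolding doubling_sign_def by measurable

text \<open>
  The first binary digit is a fair coin independent of the later ones: each half of the interval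
  is mapped affinely onto the whole by the doubling map.
\<close>
lemma nn_integral_doubling:
  fixes F :: "real \<Rightarrow> ennreal" and G :: "real \<Rightarrow> real"
  assumes [measurable]: "F \<in> borel_measurable borel" and G: "\<And>s. G s \<ge> 0"
  shows "(\<integral>\<^sup>+x. ennreal (G (doubling_sign x)) * F (doubling_map x) * indicator {0..<1} x \<partial>lborel)
       = ennreal ((G 1 + G (-1)) / 2) * (\<integral>\<^sup>+x. F x * indicator {0..<1} x \<partial>lborel)"
proof -
  let ?I = "\<integral>\<^sup>+x. F x * indicator {0..<1} x \<partial>lborel"
  let ?f = "\<lambda>x. ennreal (G 1) * F (2 * x) * indicator {0..<1/2} x"
  let ?g = "\<lambda>x. ennreal (G (-1)) * F (2 * x - 1) * indicator {1/2..<1} x"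
  have "(\<integral>\<^sup>+x. ennreal (G (doubling_sign x)) * F (doubling_map x) * indicator {0..<1} x \<partial>lborel)
      = (\<integral>\<^sup>+x. ?f x + ?g x \<partial>lborel)"
  proof (rule nn_integral_cong)
    fix x :: real
    have "doubling_map x = 2 * x" if "0 \<le> x" "x < 1/2"
      unfolding doubling_map_def using that by (intro frac_eq[THEN iffD2]) auto
    moreover have "doubling_map x = 2 * x - 1" if "1/2 \<le> x" "x < 1"
      unfolding doubling_map_def using that by (intro frac_unique_iff[THEN iffD2]) auto
    ultimately show "ennreal (G (doubling_sign x)) * F (doubling_map x) * indicator {0..<1} x = ?f x + ?g x"
      by (auto simp: doubling_sign_def indicator_def)
  qed
  also have "\<dots> = (\<integral>\<^sup>+x. ?f x \<partial>lborel) + (\<integral>\<^sup>+x. ?g x \<partial>lborel)"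
    by (rule nn_integral_add) auto
  also have "(\<integral>\<^sup>+x. ?f x \<partial>lborel) = ennreal (1/2) * (\<integral>\<^sup>+x. ?f (0 + (1/2) * x) \<partial>lborel)"
    by (subst nn_integral_real_affine[where c = "1/2" and t = 0]) auto
  also have "(\<integral>\<^sup>+x. ?f (0 + (1/2) * x) \<partial>lborel) = (\<integral>\<^sup>+x. ennreal (G 1) * (F x * indicator {0..<1} x) \<partial>lborel)"
    by (intro nn_integral_cong) (auto simp: indicator_def)
  also have "\<dots> = ennreal (G 1) * ?I"
    by (rule nn_integral_cmult) auto
  also have "(\<integral>\<^sup>+x. ?g x \<partial>lborel) = ennreal (1/2) * (\<integral>\<^sup>+x. ?g (1/2 + (1/2) * x) \<partial>lborel)"
    by (subst nn_integral_real_affine[where c = "1/2" and t = "1/2"]) auto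
  also have "(\<integral>\<^sup>+x. ?g (1/2 + (1/2) * x) \<partial>lborel) = (\<integral>\<^sup>+x. ennreal (G (-1)) * (F x * indicator {0..<1} x) \<partial>lborel)"
    by (intro nn_integral_cong) (auto simp: indicator_def algebra_simps)
  also have "\<dots> = ennreal (G (-1)) * ?I"
    by (rule nn_integral_cmult) auto
  also have "ennreal (1/2) * (ennreal (G 1) * ?I) + ennreal (1/2) * (ennreal (G (-1)) * ?I)
      = (ennreal (1/2) * ennreal (G 1) + ennreal (1/2) * ennreal (G (-1))) * ?I"
    by (simp only: distrib_right mult.assoc)
  also have "ennreal (1/2) * ennreal (G 1) + ennreal (1/2) * ennreal (G (-1)) = ennreal ((G 1 + G (-1)) / 2)"
  proof -
    have "ennreal ((G 1 + G (-1)) / 2) = ennreal (1/2 * G 1 + 1/2 * G (-1))"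
      by (simp add: add_divide_distrib)
    also have "\<dots> = ennreal (1/2 * G 1) + ennreal (1/2 * G (-1))"
      using G by (intro ennreal_plus) auto
    also have "\<dots> = ennreal (1/2) * ennreal (G 1) + ennreal (1/2) * ennreal (G (-1))"
      using G by (intro arg_cong2[where f = "(+)"] ennreal_mult) auto
    finally show ?thesis ..
  qed
  finally show ?thesis .
qed

text \<open>
  By independence the moment generating function factorises; a symmetric sign scaled by \<open>c\<close> contributes
  \<open>cosh c\<close>.
\<close>
lemma nn_integral_exp_doubling_signs:
  "(\<integral>\<^sup>+x. ennreal (exp (\<Sum>j<n. doubling_sign ((doubling_map ^^ j) x) * c j)) * indicator {0..<1} x \<partial>lborel)
     = ennreal (\<Prod>j<n. cosh (c j))"
proof (induction n arbitrary: c)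
  case 0
  show ?case by simp
next
  case (Suc n)
  let ?E = "\<lambda>c x. exp (\<Sum>j<n. doubling_sign ((doubling_map ^^ j) x) * c (Suc j))"
  have "exp (\<Sum>j<Suc n. doubling_sign ((doubling_map ^^ j) x) * c j)
      = exp (doubling_sign x * c 0) * ?E c (doubling_map x)" for x
    by (simp only: sum.lessThan_Suc_shift funpow_Suc_right o_apply funpow_0 exp_add)
  then have "(\<integral>\<^sup>+x. ennreal (exp (\<Sum>j<Suc n. doubling_sign ((doubling_map ^^ j) x) * c j))
          * indicator {0..<1} x \<partial>lborel)
      = (\<integral>\<^sup>+x. ennreal (exp (doubling_sign x * c 0)) * ennreal (?E c (doubling_map x))
          * indicator {0..<1} x \<partial>lborel)"
    by (simp only: ennreal_mult exp_ge_zero)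
  also have "\<dots> = ennreal ((exp (1 * c 0) + exp (- 1 * c 0)) / 2)
      * (\<integral>\<^sup>+x. ennreal (?E c x) * indicator {0..<1} x \<partial>lborel)"
    by (rule nn_integral_doubling[where G = "\<lambda>s. exp (s * c 0)"]) auto
  also have "(\<integral>\<^sup>+x. ennreal (?E c x) * indicator {0..<1} x \<partial>lborel) = ennreal (\<Prod>j<n. cosh (c (Suc j)))"
    by (rule Suc.IH)
  also have "(exp (1 * c 0) + exp (- 1 * c 0)) / 2 = cosh (c 0)"
    by (simp add: cosh_def)
  also have "ennreal (cosh (c 0)) * ennreal (\<Prod>j<n. cosh (c (Suc j))) = ennreal (\<Prod>j<Suc n. cosh (c j))"
    by (subst ennreal_mult[symmetric]) (auto simp: prod.lessThan_Suc_shift intro!: prod_nonneg simp del: prod.lessThan_Suc)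
  finally show ?case .
qed

text \<open>
  Chernoff's bound for \<open>X n\<close>, the sum of signs weighted by logarithms, with parameter
  \<open>1 / sqrt n\<close>: the variable \<open>Y n = exp (X n / sqrt n - sqrt n)\<close> exceeds \<open>1\<close> as soon as \<open>X n > n\<close>,
  and its expectation is at most \<open>exp ((ln n)\<^sup>2 / 2 - sqrt n)\<close>, which is summable. So the series of the
  \<open>Y n\<close> converges almost everywhere and its terms are eventually below \<open>1\<close>.
\<close>
lemma doubling_log_weights_le:
  "AE x in lborel. x \<in> {0..<1} \<longrightarrow> (\<forall>\<^sub>F n in sequentially.
     (\<Sum>j<n. doubling_sign ((doubling_map ^^ j) x) * ln (real (n - j))) \<le> real n)"
proof -
  define X where "X n x = (\<Sum>j<n. doubling_sign ((doubling_map ^^ j) x) * ln (real (n - j)))" for n x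
  define Y where "Y n x = exp (X n x / sqrt (real n) - sqrt (real n))" for n x
  have [measurable]: "X n \<in> borel_measurable borel" "Y n \<in> borel_measurable borel" for n
    unfolding Y_def X_def by measurable
  have EY: "(\<integral>\<^sup>+x. ennreal (Y n x) * indicator {0..<1} x \<partial>lborel)
      \<le> ennreal (exp ((ln (real n))\<^sup>2 / 2 - sqrt (real n)))" for n
  proof (cases "n = 0")
    case True
    then show ?thesis by (simp add: Y_def X_def)
  next
    case False
    let ?c = "\<lambda>j. ln (real (n - j)) / sqrt (real n)"
    have Y: "Y n x = exp (- sqrt (real n)) * exp (\<Sum>j<n. doubling_sign ((doubling_map ^^ j) x) * ?c j)" for x
      by (simp add: Y_def X_def exp_add[symmetric] sum_divide_distrib)
    have "(\<integral>\<^sup>+x. ennreal (Y n x) * indicator {0..<1} x \<partial>lborel)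
        = ennreal (exp (- sqrt (real n))) * ennreal (\<Prod>j<n. cosh (?c j))"
      unfolding Y nn_integral_exp_doubling_signs[symmetric]
      by (subst nn_integral_cmult[symmetric]) (auto simp: ennreal_mult mult.assoc)
    also have "(\<Prod>j<n. cosh (?c j)) \<le> (\<Prod>j<n. exp ((ln (real n))\<^sup>2 / (2 * real n)))"
    proof (intro prod_mono conjI)
      fix j assume j: "j \<in> {..<n}"
      then have "(ln (real (n - j)))\<^sup>2 \<le> (ln (real n))\<^sup>2"
        by (intro power_mono) auto
      then have "(?c j)\<^sup>2 / 2 \<le> (ln (real n))\<^sup>2 / (2 * real n)"
        using False by (simp add: power_divide field_simps)
      with cosh_le_exp_half_square[of "?c j"]
      show "cosh (?c j) \<le> exp ((ln (real n))\<^sup>2 / (2 * real n))"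
        by (meson exp_le_cancel_iff order_trans)
    qed simp
    also have "\<dots> = exp ((ln (real n))\<^sup>2 / 2)"
      using False by (simp add: exp_of_nat_mult[symmetric])
    finally have "(\<integral>\<^sup>+x. ennreal (Y n x) * indicator {0..<1} x \<partial>lborel)
        \<le> ennreal (exp (- sqrt (real n))) * ennreal (exp ((ln (real n))\<^sup>2 / 2))"
      by (simp add: mult_left_mono ennreal_leI)
    then show ?thesis
      by (simp add: ennreal_mult[symmetric] exp_add[symmetric])
  qed
  have "summable (\<lambda>n. exp ((ln (real n))\<^sup>2 / 2 - sqrt (real n)))"
  proof (rule summable_comparison_test_bigo)
    show "summable (\<lambda>n. norm (1 / real n ^ 2))"
      using inverse_power_summable[of 2, where 'a = real] by (simp add: divide_inverse)
    show "(\<lambda>n. exp ((ln (real n))\<^sup>2 / 2 - sqrt (real n))) \<in> O(\<lambda>n. 1 / real n ^ 2)"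
      by real_asymp
  qed
  then have fin: "(\<Sum>n. ennreal (exp ((ln (real n))\<^sup>2 / 2 - sqrt (real n)))) \<noteq> \<infinity>"
    by (simp add: suminf_ennreal_eq sums_iff)
  have "(\<integral>\<^sup>+x. (\<Sum>n. ennreal (Y n x) * indicator {0..<1} x) \<partial>lborel)
      = (\<Sum>n. \<integral>\<^sup>+x. ennreal (Y n x) * indicator {0..<1} x \<partial>lborel)"
    by (intro nn_integral_suminf) auto
  also have "\<dots> \<le> (\<Sum>n. ennreal (exp ((ln (real n))\<^sup>2 / 2 - sqrt (real n))))"
    by (intro suminf_le EY) auto
  finally have "(\<integral>\<^sup>+x. (\<Sum>n. ennreal (Y n x) * indicator {0..<1} x) \<partial>lborel) \<noteq> \<infinity>"
    using fin by (auto simp: top_unique)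
  then have "AE x in lborel. (\<Sum>n. ennreal (Y n x) * indicator {0..<1} x) \<noteq> \<infinity>"
    by (intro nn_integral_PInf_AE) auto
  then show ?thesis
  proof eventually_elim
    case (elim x)
    show ?case
    proof
      assume "x \<in> {0..<1}"
      with elim have "(\<Sum>n. ennreal (Y n x)) \<noteq> top" by simp
      then have "summable (\<lambda>n. Y n x)"
        by (intro summable_suminf_not_top) (auto simp: Y_def)
      then have "\<forall>\<^sub>F n in sequentially. Y n x < 1"
        by (intro order_tendstoD(2)[OF summable_LIMSEQ_zero]) auto
      then show "\<forall>\<^sub>F n in sequentially.
          (\<Sum>j<n. doubling_sign ((doubling_map ^^ j) x) * ln (real (n - j))) \<le> real n"
        using eventually_gt_at_top[of 0]
      proof eventually_elim
        case (elim n)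
        then have "X n x / sqrt (real n) < sqrt (real n)" by (simp add: Y_def)
        then have "X n x < sqrt (real n) * sqrt (real n)"
          using elim by (simp add: pos_divide_less_eq)
        then show ?case by (simp add: X_def)
      qed
    qed
  qed
qed

section \<open>Random products of the two shifts\<close>

lemma ergodic_signs:
  fixes M :: "'a measure"
  assumes erg: "ergodic_system M \<tau>"
    and A: "A1 \<in> sets M" "A2 \<in> sets M" "A1 \<union> A2 = space M" "A1 \<inter> A2 = {}"
  defines "\<epsilon> \<equiv> \<lambda>x. if x \<in> A1 then 1 else (-1 :: real)"
  shows growth_of_sign_sums: "measure M A1 > measure M A2 \<Longrightarrow>
      AE x in M. \<exists>\<delta>>0. \<exists>C\<ge>0. \<forall>n. (\<Sum>i<n. \<delta> - \<epsilon> ((\<tau> ^^ i) x)) \<le> C"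
    and boundedness_of_sign_sums: "measure M A1 < measure M A2 \<Longrightarrow>
      AE x in M. \<exists>C\<ge>0. \<forall>n. (\<Sum>i<n. \<epsilon> ((\<tau> ^^ i) x)) \<le> C"
proof -
  interpret prob_space M
    using erg unfolding ergodic_system_def measure_preserving_system_def by simp
  have \<epsilon>: "\<epsilon> x = indicator A1 x - indicator A2 x" if "x \<in> space M" for x
    using that A(3,4) unfolding \<epsilon>_def by (auto simp: indicator_def)
  have int_ind: "integrable M (\<lambda>x. indicator A1 x - indicator A2 x :: real)"
    using A(1,2) by (intro Bochner_Integration.integrable_diff) (auto simp: emeasure_eq_measure)
  have int: "integrable M \<epsilon>"
    by (rule Bochner_Integration.integrable_cong[OF refl \<epsilon>, THEN iffD2, OF _ int_ind])
  have "(\<integral>x. \<epsilon> x \<partial>M) = (\<integral>x. indicator A1 x - indicator A2 x \<partial>M)"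
    by (rule Bochner_Integration.integral_cong[OF refl \<epsilon>])
  also have "\<dots> = prob A1 - prob A2"
    using A(1,2) by (subst Bochner_Integration.integral_diff) (auto simp: emeasure_eq_measure)
  finally have mean: "(\<integral>x. \<epsilon> x \<partial>M) = prob A1 - prob A2" .
  show "AE x in M. \<exists>\<delta>>0. \<exists>C\<ge>0. \<forall>n. (\<Sum>i<n. \<delta> - \<epsilon> ((\<tau> ^^ i) x)) \<le> C" if "prob A1 > prob A2"
  proof -
    \<comment> \<open>Half the mean of the sign, so that subtracting the sign leaves a negative mean.\<close>
    define \<delta> where "\<delta> = (prob A1 - prob A2) / 2"
    have "\<delta> > 0" using that by (simp add: \<delta>_def)
    have "(\<integral>x. \<delta> - \<epsilon> x \<partial>M) = \<delta> - (prob A1 - prob A2)"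
      using int by (simp add: mean prob_space)
    also have "\<dots> < 0" using that by (simp add: \<delta>_def field_simps)
    finally have "AE x in M. \<exists>C\<ge>0. \<forall>n. (\<Sum>i<n. \<delta> - \<epsilon> ((\<tau> ^^ i) x)) \<le> C"
      using int by (intro birkhoff_sums_bounded_above[OF erg]) auto
    then show ?thesis
      by (rule eventually_mono) (use \<open>\<delta> > 0\<close> in blast)
  qed
  show "AE x in M. \<exists>C\<ge>0. \<forall>n. (\<Sum>i<n. \<epsilon> ((\<tau> ^^ i) x)) \<le> C" if "prob A1 < prob A2"
    using birkhoff_sums_bounded_above[OF erg int] mean that by simp
qed

theorem proposition1p4:
  fixes w v :: "nat \<Rightarrow> complex"
  assumes w: "\<And>l. l \<ge> 1 \<Longrightarrow> w l = of_nat l"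
    and v: "\<And>l. l \<ge> 1 \<Longrightarrow> v l = 1 / of_nat l"
  shows "(\<forall>(M :: 'a measure) \<tau> A1 A2 T.
            ergodic_system M \<tau> \<and>
            A1 \<in> sets M \<and> A2 \<in> sets M \<and> A1 \<union> A2 = space M \<and> A1 \<inter> A2 = {} \<and>
            min (measure M A1) (measure M A2) > 0 \<and>
            (\<forall>\<omega>\<in>A1. T \<omega> = weighted_shift w) \<and> (\<forall>\<omega>\<in>A2. T \<omega> = weighted_shift v) \<longrightarrow>
            (measure M A1 > measure M A2 \<longrightarrow>
               (AE \<omega> in M. mixing_sequence entire_topology (\<lambda>n. op_product \<tau> T n \<omega>))) \<and>
            (measure M A1 < measure M A2 \<longrightarrow>
               (AE \<omega> in M. \<not> universal_sequence entire_topology (\<lambda>n. op_product \<tau> T n \<omega>)))) \<and>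
         (\<forall>T. (\<forall>\<omega>\<in>{0..<1/2}. T \<omega> = weighted_shift w) \<and>
              (\<forall>\<omega>\<in>{1/2..<1}. T \<omega> = weighted_shift v) \<longrightarrow>
            (AE \<omega> in lebesgue_on {0..<1}.
               \<not> universal_sequence entire_topology (\<lambda>n. op_product doubling_map T n \<omega>)))"
proof (rule conjI; intro allI impI; elim conjE)
  fix M :: "'a measure" and \<tau> A1 A2 T
  assume erg: "ergodic_system M \<tau>"
    and A: "A1 \<in> sets M" "A2 \<in> sets M" "A1 \<union> A2 = space M" "A1 \<inter> A2 = {}"
    and T: "\<forall>\<omega>\<in>A1. T \<omega> = weighted_shift w" "\<forall>\<omega>\<in>A2. T \<omega> = weighted_shift v"
  let ?\<epsilon> = "\<lambda>x. if x \<in> A1 then 1 else (-1 :: real)"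
  have "\<tau> \<in> measurable M M"
    using erg unfolding ergodic_system_def measure_preserving_system_def by blast
  then have orbit: "(\<tau> ^^ j) \<omega> \<in> space M" if "\<omega> \<in> space M" for j \<omega>
    using that by (induction j) (auto dest: measurable_space)
  have shifts: "log_weighted_shifts (\<lambda>j. ?\<epsilon> ((\<tau> ^^ j) \<omega>)) (\<lambda>n. op_product \<tau> T n \<omega>)"
    if "\<omega> \<in> space M" for \<omega>
    using w v
  proof (rule op_product_log_weighted_shifts)
    fix j
    show "(?\<epsilon> ((\<tau> ^^ j) \<omega>) = 1 \<and> T ((\<tau> ^^ j) \<omega>) = weighted_shift w) \<or>
          (?\<epsilon> ((\<tau> ^^ j) \<omega>) = -1 \<and> T ((\<tau> ^^ j) \<omega>) = weighted_shift v)"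
      using orbit[OF that, of j] A(3) T by auto
  qed
  show "(measure M A1 > measure M A2 \<longrightarrow>
           (AE \<omega> in M. mixing_sequence entire_topology (\<lambda>n. op_product \<tau> T n \<omega>))) \<and>
        (measure M A1 < measure M A2 \<longrightarrow>
           (AE \<omega> in M. \<not> universal_sequence entire_topology (\<lambda>n. op_product \<tau> T n \<omega>)))"
  proof (intro conjI impI)
    assume "measure M A1 > measure M A2"
    from growth_of_sign_sums[OF erg A this] AE_space
    show "AE \<omega> in M. mixing_sequence entire_topology (\<lambda>n. op_product \<tau> T n \<omega>)"
    proof eventually_elim
      case (elim \<omega>)
      then obtain \<delta> C where "\<delta> > 0" "C \<ge> 0" "\<And>n. (\<Sum>i<n. \<delta> - ?\<epsilon> ((\<tau> ^^ i) \<omega>)) \<le> C"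
        by auto
      with shifts[OF elim(2)] show ?case by (rule mixing_if_linear_growth)
    qed
  next
    assume "measure M A1 < measure M A2"
    from boundedness_of_sign_sums[OF erg A this] AE_space
    show "AE \<omega> in M. \<not> universal_sequence entire_topology (\<lambda>n. op_product \<tau> T n \<omega>)"
    proof eventually_elim
      case (elim \<omega>)
      then obtain C where C: "C \<ge> 0" "\<And>n. (\<Sum>i<n. ?\<epsilon> ((\<tau> ^^ i) \<omega>)) \<le> C" by auto
      have "(\<Sum>j<n. ?\<epsilon> ((\<tau> ^^ j) \<omega>) * ln (real (n - j))) \<le> C * real n" for n
      proof -
        have "(\<Sum>j<n. ?\<epsilon> ((\<tau> ^^ j) \<omega>) * ln (real (n - j))) \<le> C * ln (real n)"
          using C(2,1) by (rule sum_mult_ln_le)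
        also have "\<dots> \<le> C * real n"
          using C(1) ln_bound[of "real n"] by (cases "n = 0") (auto intro: mult_left_mono)
        finally show ?thesis .
      qed
      with shifts[OF elim(2)] show ?case
        by (intro not_universal_if_linear_log_weights) (auto intro: always_eventually)
    qed
  qed
next
  fix T :: "real \<Rightarrow> (complex \<Rightarrow> complex) \<Rightarrow> complex \<Rightarrow> complex"
  assume T: "\<forall>\<omega>\<in>{0..<1/2}. T \<omega> = weighted_shift w" "\<forall>\<omega>\<in>{1/2..<1}. T \<omega> = weighted_shift v"
  have orbit: "(doubling_map ^^ j) \<omega> \<in> {0..<1}" if "\<omega> \<in> {0..<1}" for j \<omega>
    using that by (cases j) (auto simp: doubling_map_def frac_ge_0 frac_lt_1)
  have shifts: "log_weighted_shifts (\<lambda>j. doubling_sign ((doubling_map ^^ j) \<omega>))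
      (\<lambda>n. op_product doubling_map T n \<omega>)" if "\<omega> \<in> {0..<1}" for \<omega>
    using w v
  proof (rule op_product_log_weighted_shifts)
    fix j
    show "(doubling_sign ((doubling_map ^^ j) \<omega>) = 1 \<and> T ((doubling_map ^^ j) \<omega>) = weighted_shift w) \<or>
          (doubling_sign ((doubling_map ^^ j) \<omega>) = -1 \<and> T ((doubling_map ^^ j) \<omega>) = weighted_shift v)"
      using orbit[OF that, of j] T unfolding doubling_sign_def by auto
  qed
  have "AE \<omega> in lebesgue. \<omega> \<in> {0..<1} \<longrightarrow>
      \<not> universal_sequence entire_topology (\<lambda>n. op_product doubling_map T n \<omega>)"
    using AE_completion[OF doubling_log_weights_le]
  proof eventually_elim
    case (elim \<omega>)
    then show ?case
      using not_universal_if_linear_log_weights[OF shifts, of \<omega> 1] by simp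
  qed
  then show "AE \<omega> in lebesgue_on {0..<1}.
      \<not> universal_sequence entire_topology (\<lambda>n. op_product doubling_map T n \<omega>)"
    by (subst AE_restrict_space_iff) auto
qed

end
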